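(* Consider a choice dataset over the item set $[m]$ with distinct choice sets $S_1,\dots,S_n\subseteq[m]$ (each with at least two items), where $S_i$ appears in $R_i$ observations and item $j$ is selected $W_j$ times in total. Let $p\in\mathbb{R}^n$, $p_i=R_i$; $q\in\mathbb{R}^m$, $q_j=W_j$; and $A\in\{0,1\}^{n\times m}$ with $A_{ij}=1$ iff $j\in S_i$. Suppose $p,q>0$ entrywise. Then: (1) The dataset satisfies (Connectivity) if and only if $A$ satisfies (Uniqueness). (2) The dataset satisfies (Strong Connectivity) if and only if $(A,p,q)$ satisfies (Strong Existence) and $A$ satisfies (Uniqueness).
   Context: A choice dataset over items $[m]=\{1,\dots,m\}$ is a finite list of observations, each consisting of a choice set $S\subseteq[m]$ and one selected item in $S$. The distinct choice sets are $S_1,\dots,S_n$; $R_i$ is the number of observations with choice set $S_i$; $W_j$ is the number of observations in which $j$ is selected. (Strong Connectivity): in any partition of $[m]$ into two nonempty subsets $S$ and $S^C$, some $j\in S$ is selected at least once over some $k\in S^C$ (i.e. there is an observation whose choice set contains both $j$ and $k$ and in which $j$ is selected). (Connectivity): in any partition of $[m]$ into two nonempty subsets $S$ and $S^C$, some $j\in S$ and some $k\in S^C$ appear in the same choice set $S_i$ for some $i$. (Strong Existence), for $A\ge 0$ and $p,q>0$: there exists a non-negative $A'\in\mathbb{R}_+^{n\times m}$ with the same zero pattern as $A$ (i.e. $A'_{ij}=0\iff A_{ij}=0$) and with row sums $p$ and column sums $q$. It is well known that this is equivalent to: for every pair $N\subsetneq[n]$, $M\subsetneq[m]$ such that $A_{ij}=0$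 for all $i\notin N$, $j\in M$, one has $\sum_{i\in N}p_i\ge\sum_{j\in M}q_j$, with equality if and only if $A_{ij}=0$ also for all $i\in N$, $j\notin M$. (Uniqueness): $A$ is indecomposable, i.e. there do not exist permutation matrices $P,Q$ such that $PAQ$ is block diagonal (with at least two diagonal blocks, blocks possibly rectangular). Equivalently, the bipartite graph on $[n]\sqcup[m]$ with an edge between $i$ and $j$ iff $A_{ij}>0$ is connected. *)

theory Defs
  imports
    Complex_Main
    "HOL-Combinatorics.Permutations"
    "Jordan_Normal_Form.Matrix"
begin

text \<open>The index sets \<open>[m]\<close> and \<open>[n]\<close> are rendered zero-based, as \<open>{..<m}\<close> and \<open>{..<n}\<close>.
  An observation is a pair of a choice set and the item selected from it.\<close>

definition choice_dataset :: "nat \<Rightarrow> (nat set \<times> nat) list \<Rightarrow> bool" where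
  "choice_dataset m D \<longleftrightarrow> (\<forall>(C, j)\<in>set D. C \<subseteq> {..<m} \<and> j \<in> C)"

definition choice_sets :: "(nat set \<times> nat) list \<Rightarrow> nat set set" where
  "choice_sets D = fst ` set D"

definition num_obs :: "(nat set \<times> nat) list \<Rightarrow> nat set \<Rightarrow> nat" where
  "num_obs D C = length (filter (\<lambda>obs. fst obs = C) D)"

definition num_wins :: "(nat set \<times> nat) list \<Rightarrow> nat \<Rightarrow> nat" where
  "num_wins D j = length (filter (\<lambda>obs. snd obs = j) D)"

definition selected_over :: "(nat set \<times> nat) list \<Rightarrow> nat \<Rightarrow> nat \<Rightarrow> bool" where
  "selected_over D j k \<longleftrightarrow> (\<exists>C. (C, j) \<in> set D \<and> j \<in> C \<and> k \<in> C)"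

definition strong_connectivity :: "nat \<Rightarrow> (nat set \<times> nat) list \<Rightarrow> bool" where
  "strong_connectivity m D \<longleftrightarrow>
    (\<forall>U. U \<subseteq> {..<m} \<and> U \<noteq> {} \<and> {..<m} - U \<noteq> {} \<longrightarrow>
      (\<exists>j\<in>U. \<exists>k\<in>{..<m} - U. selected_over D j k))"

definition connectivity :: "nat \<Rightarrow> (nat set \<times> nat) list \<Rightarrow> bool" where
  "connectivity m D \<longleftrightarrow>
    (\<forall>U. U \<subseteq> {..<m} \<and> U \<noteq> {} \<and> {..<m} - U \<noteq> {} \<longrightarrow>
      (\<exists>j\<in>U. \<exists>k\<in>{..<m} - U. \<exists>C\<in>choice_sets D. j \<in> C \<and> k \<in> C))"

definition strong_existence :: "real mat \<Rightarrow> real vec \<Rightarrow> real vec \<Rightarrow> bool" where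
  "strong_existence A p q \<longleftrightarrow>
    (\<exists>A' \<in> carrier_mat (dim_row A) (dim_col A).
      (\<forall>i<dim_row A. \<forall>j<dim_col A. 0 \<le> A' $$ (i, j) \<and> (A' $$ (i, j) = 0 \<longleftrightarrow> A $$ (i, j) = 0)) \<and>
      (\<forall>i<dim_row A. (\<Sum>j<dim_col A. A' $$ (i, j)) = p $ i) \<and>
      (\<forall>j<dim_col A. (\<Sum>i<dim_row A. A' $$ (i, j)) = q $ j))"

definition permutation_matrix :: "nat \<Rightarrow> 'a :: zero_neq_one mat \<Rightarrow> bool" where
  "permutation_matrix k P \<longleftrightarrow>
    (\<exists>\<pi>. \<pi> permutes {..<k} \<and> P = mat k k (\<lambda>(i, j). if \<pi> i = j then 1 else 0))"

text \<open>Blocks may be rectangular. Blocks of size \<open>r \<times> 0\<close> and \<open>0 \<times> c\<close> are allowed and only \<open>0 \<times> 0\<close>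
  blocks are excluded: a zero row or column is thus a block of its own, in agreement with
  connectedness of the associated bipartite graph, where it is an isolated vertex.\<close>

definition block_diagonal :: "'a :: zero mat \<Rightarrow> bool" where
  "block_diagonal M \<longleftrightarrow>
    (\<exists>Bs. length Bs \<ge> 2 \<and> (\<forall>B\<in>set Bs. 0 < dim_row B + dim_col B) \<and> M = diag_block_mat Bs)"

definition indecomposable :: "'a :: semiring_1 mat \<Rightarrow> bool" where
  "indecomposable A \<longleftrightarrow>
    \<not> (\<exists>P Q. permutation_matrix (dim_row A) P \<and> permutation_matrix (dim_col A) Q \<and>
        block_diagonal (P * A * Q))"

end

theory Submission
  imports Defs
begin

text \<open>Decomposability of \<open>A\<close> amounts to a row set and a column set, not both empty and not both
  full, such that \<open>A\<close> vanishes wherever exactly one of them is met. Since no row vanishes, the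
  column set is a nontrivial cut of the items that no choice set crosses, which gives (1).

  For (2), let \<open>B\<close> count the observations with choice set \<open>S i\<close> and selected item \<open>j\<close>. It has the
  prescribed marginals and its support lies in that of \<open>A\<close>, but it may be smaller. An entry
  \<open>(i, k)\<close> with \<open>k \<in> S i\<close> is made positive by shifting mass in row \<open>i\<close> from a selected item \<open>j\<close>
  to \<open>k\<close> and then returning it along a path of selections from \<open>k\<close> to \<open>j\<close>; mass is taken only
  where \<open>B\<close> is positive. Averaging over all such entries gives the full support. Conversely, if no
  item of \<open>U\<close> is selected over an item outside \<open>U\<close>, then the observations selecting from \<open>U\<close> are
  those with a choice set inside \<open>U\<close>, so the marginals leave no mass for the entries of \<open>U\<close> in
  the other rows, and no choice set crosses \<open>U\<close>.\<close>

section \<open>Block diagonal form\<close>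

text \<open>The left factor has its one of row \<open>i\<close> in column \<open>\<pi> i\<close>, so
  it selects row \<open>\<pi> i\<close>. The right factor has its one of column \<open>j\<close> in
  the row that \<open>\<tau>\<close> sends to \<open>j\<close>, so columns are read through the
  inverse of \<open>\<tau>\<close>.\<close>

lemma permutation_matrix_conj:
  fixes A :: "'a :: semiring_1 mat"
  assumes A: "A \<in> carrier_mat n m" and \<pi>: "\<pi> permutes {..<n}" and \<tau>: "\<tau> permutes {..<m}"
  shows "mat n n (\<lambda>(i, j). if \<pi> i = j then 1 else 0) * A * mat m m (\<lambda>(i, j). if \<tau> i = j then 1 else 0)
    = mat n m (\<lambda>(i, j). A $$ (\<pi> i, inv_into UNIV \<tau> j))"
proof (rule eq_matI, goal_cases)
  case (1 i j)
  then have ij: "i < n" "j < m" by auto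
  have \<pi>i: "\<pi> i < n" using permutes_in_image[OF \<pi>, of i] ij by auto
  have \<tau>j: "inv_into UNIV \<tau> j < m" using permutes_in_image[OF permutes_inv[OF \<tau>], of j] ij by auto
  have row: "(\<Sum>l = 0..<n. (if \<pi> i = l then 1 else 0) * A $$ (l, k)) = A $$ (\<pi> i, k)" for k
  proof -
    have "(\<Sum>l = 0..<n. (if \<pi> i = l then 1 else 0) * A $$ (l, k))
        = (\<Sum>l = 0..<n. if \<pi> i = l then A $$ (l, k) else 0)"
      by (rule sum.cong) auto
    then show ?thesis using \<pi>i by simp
  qed
  have "(mat n n (\<lambda>(i, j). if \<pi> i = j then 1 else 0) * A
          * mat m m (\<lambda>(i, j). if \<tau> i = j then 1 else 0)) $$ (i, j)
      = (\<Sum>k = 0..<m. A $$ (\<pi> i, k) * (if \<tau> k = j then 1 else 0))"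
    using A ij by (simp add: scalar_prod_def row)
  also have "\<dots> = (\<Sum>k = 0..<m. if inv_into UNIV \<tau> j = k then A $$ (\<pi> i, k) else 0)"
    using permutes_inverses[OF \<tau>] by (intro sum.cong) auto
  also have "\<dots> = A $$ (\<pi> i, inv_into UNIV \<tau> j)" using \<tau>j by simp
  finally show ?case using ij by simp
qed (use A in auto)

text \<open>Gluing a bijection from the initial segment onto \<open>N\<close> to one between the
  complements gives the permutation that brings the rows or columns of a block to the front.\<close>

lemma ex_permutation_initial_segment:
  assumes "N \<subseteq> {..<n}"
  shows "\<exists>\<pi>. \<pi> permutes {..<n} \<and> (\<forall>i<n. \<pi> i \<in> N \<longleftrightarrow> i < card N)"
proof -
  have fin: "finite N" using assms finite_subset by blast
  have le: "card N \<le> n" using card_mono[OF _ assms] by simp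
  obtain f where f: "bij_betw f {..<card N} N"
    using finite_same_card_bij[of "{..<card N}" N] fin by auto
  obtain g where g: "bij_betw g {card N..<n} ({..<n} - N)"
    using finite_same_card_bij[of "{card N..<n}" "{..<n} - N"] fin assms
    by (auto simp: card_Diff_subset)
  define \<pi> where "\<pi> i = (if i < card N then f i else if i < n then g i else i)" for i
  have f': "bij_betw \<pi> {..<card N} N"
    by (rule bij_betw_cong[THEN iffD1, OF _ f]) (simp add: \<pi>_def)
  have g': "bij_betw \<pi> {card N..<n} ({..<n} - N)"
    by (rule bij_betw_cong[THEN iffD1, OF _ g]) (simp add: \<pi>_def)
  have "bij_betw \<pi> ({..<card N} \<union> {card N..<n}) (N \<union> ({..<n} - N))"
    by (rule bij_betw_combine[OF f' g']) auto
  moreover have "{..<card N} \<union> {card N..<n} = {..<n}" "N \<union> ({..<n} - N) = {..<n}"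
    using le assms by auto
  ultimately have "bij_betw \<pi> {..<n} {..<n}" by simp
  then have "\<pi> permutes {..<n}"
    by (rule bij_imp_permutes) (use le in \<open>auto simp: \<pi>_def\<close>)
  moreover have "\<pi> i \<in> N \<longleftrightarrow> i < card N" if "i < n" for i
    using bij_betwE[OF f'] bij_betwE[OF g'] that by (cases "i < card N") auto
  ultimately show ?thesis by blast
qed

text \<open>In the bipartite graph on rows and columns this is a nonempty proper vertex set with no
  edge leaving it. Nonemptiness and properness are asked of \<open>N\<close> and \<open>M\<close>
  jointly, so an isolated row or column counts, matching blocks with no columns or no rows.\<close>

definition bipartition :: "'a :: zero mat \<Rightarrow> nat set \<Rightarrow> nat set \<Rightarrow> bool" where
  "bipartition A N M \<longleftrightarrow>
    N \<subseteq> {..<dim_row A} \<and> M \<subseteq> {..<dim_col A} \<and> (N \<noteq> {} \<or> M \<noteq> {}) \<and>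
    (N \<noteq> {..<dim_row A} \<or> M \<noteq> {..<dim_col A}) \<and>
    (\<forall>i<dim_row A. \<forall>j<dim_col A. (i \<in> N) \<noteq> (j \<in> M) \<longrightarrow> A $$ (i, j) = 0)"

lemma bipartition_imp_decomposable:
  fixes A :: "'a :: semiring_1 mat"
  assumes "bipartition A N M"
  shows "\<not> indecomposable A"
proof -
  define n m r c where "n = dim_row A" and "m = dim_col A" and "r = card N" and "c = card M"
  have A: "A \<in> carrier_mat n m" by (simp add: n_def m_def)
  have N: "N \<subseteq> {..<n}" and M: "M \<subseteq> {..<m}" and ne: "N \<noteq> {} \<or> M \<noteq> {}"
    and nf: "N \<noteq> {..<n} \<or> M \<noteq> {..<m}"
    and zero: "\<And>i j. i < n \<Longrightarrow> j < m \<Longrightarrow> (i \<in> N) \<noteq> (j \<in> M) \<Longrightarrow> A $$ (i, j) = 0"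
    using assms by (auto simp: bipartition_def n_def m_def)
  have fin: "finite N" "finite M" using N M finite_subset by blast+
  have r: "r \<le> n" using card_mono[OF _ N] by (simp add: r_def)
  have c: "c \<le> m" using card_mono[OF _ M] by (simp add: c_def)
  have rc: "0 < r + c" using ne fin by (auto simp: r_def c_def card_gt_0_iff)
  have rc': "r < n \<or> c < m"
    using nf psubset_card_mono[of "{..<n}" N] psubset_card_mono[of "{..<m}" M] N M
    by (auto simp: r_def c_def)
  obtain \<pi> where \<pi>: "\<pi> permutes {..<n}" "\<And>i. i < n \<Longrightarrow> \<pi> i \<in> N \<longleftrightarrow> i < r"
    using ex_permutation_initial_segment[OF N] by (auto simp: r_def)
  obtain \<sigma> where \<sigma>: "\<sigma> permutes {..<m}" "\<And>i. i < m \<Longrightarrow> \<sigma> i \<in> M \<longleftrightarrow> i < c"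
    using ex_permutation_initial_segment[OF M] by (auto simp: c_def)
  have \<pi>_lt: "\<pi> i < n" if "i < n" for i using permutes_in_image[OF \<pi>(1), of i] that by auto
  have \<sigma>_lt: "\<sigma> i < m" if "i < m" for i using permutes_in_image[OF \<sigma>(1), of i] that by auto
  \<comment> \<open>Columns are read through the inverse of the right-hand permutation, so
    \<open>Q\<close> is built from the inverse of \<open>\<sigma>\<close> to make the product read
    columns through \<open>\<sigma>\<close> itself.\<close>
  define P Q where "P = mat n n (\<lambda>(i, j). if \<pi> i = j then 1 else 0 :: 'a)"
    and "Q = mat m m (\<lambda>(i, j). if inv_into UNIV \<sigma> i = j then 1 else 0 :: 'a)"
  define B1 where "B1 = mat r c (\<lambda>(i, j). A $$ (\<pi> i, \<sigma> j))"
  define B2 where "B2 = mat (n - r) (m - c) (\<lambda>(i, j). A $$ (\<pi> (i + r), \<sigma> (j + c)))"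
  have "P * A * Q = mat n m (\<lambda>(i, j). A $$ (\<pi> i, \<sigma> j))"
    using permutation_matrix_conj[OF A \<pi>(1) permutes_inv[OF \<sigma>(1)]] permutes_inv_inv[OF \<sigma>(1)]
    by (simp add: P_def Q_def)
  also have "\<dots> = diag_block_mat [B1, B2]"
  proof (rule eq_matI, goal_cases)
    case (1 i j)
    then have ij: "i < n" "j < m" using r c by (auto simp: B1_def B2_def Let_def)
    show ?case
      \<comment> \<open>Off the two blocks exactly one of \<open>i < r\<close> and
        \<open>j < c\<close> holds, so exactly one of \<open>\<pi> i \<in> N\<close> and
        \<open>\<sigma> j \<in> M\<close> does.\<close>
      using ij r c zero[OF \<pi>_lt \<sigma>_lt, of i j] \<pi>(2)[of i] \<sigma>(2)[of j]
      by (auto simp: B1_def B2_def Let_def)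
  qed (use r c in \<open>auto simp: B1_def B2_def Let_def\<close>)
  finally have "block_diagonal (P * A * Q)"
    unfolding block_diagonal_def using rc rc'
    by (intro exI[of _ "[B1, B2]"]) (auto simp: B1_def B2_def)
  moreover have "permutation_matrix n P" "permutation_matrix m Q"
    using \<pi>(1) permutes_inv[OF \<sigma>(1)] by (auto simp: permutation_matrix_def P_def Q_def)
  ultimately show ?thesis unfolding indecomposable_def n_def m_def by blast
qed

lemma decomposable_imp_bipartition:
  fixes A :: "'a :: semiring_1 mat"
  assumes "\<not> indecomposable A"
  shows "\<exists>N M. bipartition A N M"
proof -
  define n m where "n = dim_row A" and "m = dim_col A"
  have A: "A \<in> carrier_mat n m" by (simp add: n_def m_def)
  obtain \<pi> \<tau> Bs where \<pi>: "\<pi> permutes {..<n}" and \<tau>: "\<tau> permutes {..<m}"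
    and Bs: "length Bs \<ge> 2" "\<forall>B\<in>set Bs. 0 < dim_row B + dim_col B"
    and eq: "mat n n (\<lambda>(i, j). if \<pi> i = j then 1 else 0) * A
        * mat m m (\<lambda>(i, j). if \<tau> i = j then 1 else 0) = diag_block_mat Bs"
    using assms
    unfolding indecomposable_def permutation_matrix_def block_diagonal_def n_def m_def by blast
  obtain B1 B2 Bs' where Bs_eq: "Bs = B1 # B2 # Bs'"
    using Bs(1) by (cases Bs; cases "tl Bs") auto
  \<comment> \<open>However many blocks there are, the first is set against all the others merged
    into \<open>C\<close>; \<open>C\<close> is not \<open>0 \<times> 0\<close> because
    \<open>B2\<close> is not.\<close>
  define C r c where "C = diag_block_mat (B2 # Bs')" and "r = dim_row B1" and "c = dim_col B1"
  have C_pos: "0 < dim_row C + dim_col C"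
    using Bs(2) by (auto simp: C_def Bs_eq Let_def)
  have rc: "0 < r + c" using Bs(2) by (auto simp: Bs_eq r_def c_def)
  have eq': "mat n m (\<lambda>(i, j). A $$ (\<pi> i, inv_into UNIV \<tau> j))
      = four_block_mat B1 (0\<^sub>m r (dim_col C)) (0\<^sub>m (dim_row C) c) C"
    using eq unfolding permutation_matrix_conj[OF A \<pi> \<tau>]
    by (simp add: Bs_eq C_def r_def c_def Let_def)
  from arg_cong[OF eq', of dim_row] arg_cong[OF eq', of dim_col]
  have n: "n = r + dim_row C" and m: "m = c + dim_col C" by (simp_all add: r_def c_def)
  have zero: "A $$ (\<pi> i, inv_into UNIV \<tau> j) = 0" if "i < n" "j < m" "(i < r) \<noteq> (j < c)" for i j
    using arg_cong[OF eq', of "\<lambda>X. X $$ (i, j)"] that n m by (auto simp: r_def c_def)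
  \<comment> \<open>These are the original positions of the rows and columns of the first
    block.\<close>
  define N M where "N = \<pi> ` {..<r}" and "M = inv_into UNIV \<tau> ` {..<c}"
  note \<tau>' = permutes_inv[OF \<tau>]
  have N_iff: "i \<in> N \<longleftrightarrow> inv_into UNIV \<pi> i < r" for i
    unfolding N_def using permutes_inverses[OF \<pi>] by (metis imageE image_eqI lessThan_iff)
  have M_iff: "j \<in> M \<longleftrightarrow> \<tau> j < c" for j
    unfolding M_def using permutes_inverses[OF \<tau>] by (metis imageE image_eqI lessThan_iff)
  have cards: "card N = r" "card M = c"
    unfolding N_def M_def
    using card_image[OF permutes_inj_on[OF \<pi>]] card_image[OF permutes_inj_on[OF \<tau>']] by simp_all
  have "N \<subseteq> {..<n}" "M \<subseteq> {..<m}"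
    using permutes_in_image[OF \<pi>] permutes_in_image[OF \<tau>'] n m by (fastforce simp: N_def M_def)+
  moreover have "N \<noteq> {} \<or> M \<noteq> {}" using rc cards by auto
  moreover have "card N \<noteq> n \<or> card M \<noteq> m" using cards n m C_pos by auto
  then have "N \<noteq> {..<n} \<or> M \<noteq> {..<m}" by auto
  moreover have "A $$ (i, j) = 0" if "i < n" "j < m" "(i \<in> N) \<noteq> (j \<in> M)" for i j
    using zero[of "inv_into UNIV \<pi> i" "\<tau> j"] that permutes_inverses[OF \<pi>] permutes_inverses[OF \<tau>]
      permutes_in_image[OF permutes_inv[OF \<pi>], of i] permutes_in_image[OF \<tau>, of j]
    by (simp add: N_iff M_iff)
  ultimately have "bipartition A N M" by (simp add: bipartition_def n_def m_def)
  then show ?thesis by blast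
qed

lemma indecomposable_iff_no_bipartition:
  fixes A :: "'a :: semiring_1 mat"
  shows "indecomposable A \<longleftrightarrow> (\<nexists>N M. bipartition A N M)"
  using bipartition_imp_decomposable decomposable_imp_bipartition by blast

section \<open>Enlarging the support with fixed marginals\<close>

text \<open>Each edge from \<open>a\<close> to \<open>b\<close> moves one unit within a row from
  column \<open>a\<close> to column \<open>b\<close>, which preserves row sums, and the column
  changes telescope along the path. Mass leaves only entries where \<open>B\<close> is positive,
  hence the sign condition at the zeros of \<open>B\<close>.\<close>

lemma ex_shift_along_path:
  fixes B :: "'a \<Rightarrow> 'b \<Rightarrow> real"
  assumes fin: "finite I" "finite J"
    and path: "(k, l) \<in> {(a, b). \<exists>i\<in>I. B i a > 0 \<and> E i a \<and> E i b \<and> a \<in> J \<and> b \<in> J}\<^sup>*"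
  shows "\<exists>X. (\<forall>i j. B i j = 0 \<longrightarrow> 0 \<le> X i j) \<and> (\<forall>i j. \<not> E i j \<longrightarrow> X i j = (0::real)) \<and>
    (\<forall>i\<in>I. (\<Sum>j\<in>J. X i j) = 0) \<and> (\<forall>j\<in>J. (\<Sum>i\<in>I. X i j) = of_bool (j = l) - of_bool (j = k))"
  using path
proof (induction rule: rtrancl_induct)
  case base
  show ?case by (rule exI[of _ "\<lambda>_ _. 0"]) simp
next
  case (step a b)
  obtain X :: "'a \<Rightarrow> 'b \<Rightarrow> real" where X: "\<forall>i j. B i j = 0 \<longrightarrow> 0 \<le> X i j" "\<forall>i j. \<not> E i j \<longrightarrow> X i j = 0"
    "\<forall>i\<in>I. (\<Sum>j\<in>J. X i j) = 0"
    "\<forall>j\<in>J. (\<Sum>i\<in>I. X i j) = of_bool (j = a) - of_bool (j = k)"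
    using step.IH by blast
  obtain i0 where i0: "i0 \<in> I" "B i0 a > 0" "E i0 a" "E i0 b" "a \<in> J" "b \<in> J"
    using step.hyps(2) by auto
  define Y where "Y i j = X i j + of_bool (i = i0) * (of_bool (j = b) - of_bool (j = a))" for i j
  have sum_J: "(\<Sum>j\<in>J. of_bool (j = x) :: real) = 1" if "x \<in> J" for x
    using fin(2) that by (simp add: of_bool_def)
  have sum_I: "(\<Sum>i\<in>I. of_bool (i = i0) :: real) = 1"
    using fin(1) i0(1) by (simp add: of_bool_def)
  have "0 \<le> Y i j" if "B i j = 0" for i j
    using X(1)[rule_format, OF that] that i0(2) by (auto simp: Y_def)
  moreover have "Y i j = 0" if "\<not> E i j" for i j
    using X(2)[rule_format, OF that] that i0(3,4) by (auto simp: Y_def)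
  moreover have "(\<Sum>j\<in>J. Y i j) = 0" if "i \<in> I" for i
    using X(3)[rule_format, OF that] i0(5,6)
    by (simp add: Y_def sum.distrib sum_subtractf sum_J flip: sum_distrib_left)
  moreover have "(\<Sum>i\<in>I. Y i j) = of_bool (j = b) - of_bool (j = k)" if "j \<in> J" for j
    using X(4)[rule_format, OF that]
    by (simp add: Y_def sum.distrib sum_I flip: sum_distrib_right)
  ultimately show ?case by (intro exI[of _ Y]) blast
qed

text \<open>A positive entry stays positive for small \<open>e\<close> by continuity, and a zero
  entry does not decrease. Finitely many entries admit a common \<open>e\<close>.\<close>

lemma ex_nonneg_step:
  fixes B X :: "'a \<Rightarrow> real"
  assumes "finite K" and "\<And>x. x \<in> K \<Longrightarrow> 0 \<le> B x" and "\<And>x. x \<in> K \<Longrightarrow> B x = 0 \<Longrightarrow> 0 \<le> X x"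
  shows "\<exists>e>0. \<forall>x\<in>K. 0 \<le> B x + e * X x"
proof -
  have "\<forall>\<^sub>F e in at_right (0::real). 0 \<le> B x + e * X x" if "x \<in> K" for x
  proof (cases "B x = 0")
    case True
    then show ?thesis
      using assms(3)[OF that True] eventually_at_right_less[of "0::real"]
      by (auto elim!: eventually_mono)
  next
    case False
    then have "0 < B x" using assms(2)[OF that] by simp
    moreover have "((\<lambda>e. B x + e * X x) \<longlongrightarrow> B x + 0 * X x) (at_right 0)"
      by (intro tendsto_intros)
    ultimately have "\<forall>\<^sub>F e in at_right 0. 0 < B x + e * X x"
      by (intro order_tendstoD(1)[where y = "B x + 0 * X x"]) auto
    then show ?thesis by (rule eventually_mono) simp
  qed
  then have "\<forall>\<^sub>F e in at_right (0::real). 0 < e \<and> (\<forall>x\<in>K. 0 \<le> B x + e * X x)"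
    using eventually_at_right_less[of "0::real"] assms(1)
    by (intro eventually_conj eventually_ball_finite) auto
  then show ?thesis using eventually_happens[of _ "at_right (0::real)"] by fastforce
qed

text \<open>This is the transportation polytope with forbidden entries. \<open>E\<close> bounds the
  support only from above, so the counts of a dataset qualify even where an item of a choice set is
  never selected from it.\<close>

definition transport :: "'a set \<Rightarrow> 'b set \<Rightarrow> ('a \<Rightarrow> 'b \<Rightarrow> bool) \<Rightarrow> ('a \<Rightarrow> real) \<Rightarrow> ('b \<Rightarrow> real) \<Rightarrow>
    ('a \<Rightarrow> 'b \<Rightarrow> real) \<Rightarrow> bool" where
  "transport I J E r c B \<longleftrightarrow>
    (\<forall>i\<in>I. \<forall>j\<in>J. 0 \<le> B i j \<and> (\<not> E i j \<longrightarrow> B i j = 0)) \<and>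
    (\<forall>i\<in>I. (\<Sum>j\<in>J. B i j) = r i) \<and> (\<forall>j\<in>J. (\<Sum>i\<in>I. B i j) = c j)"

text \<open>Row \<open>i0\<close> has positive mass in some column \<open>j0\<close>. Moving a
  little of it to \<open>k\<close> and returning it along a path from \<open>k\<close> to
  \<open>j0\<close> is a closed cycle, so all marginals survive.\<close>

lemma ex_transport_positive_entry:
  assumes fin: "finite I" "finite J" and B: "transport I J E r c B"
    and reach: "\<And>k l. k \<in> J \<Longrightarrow> l \<in> J \<Longrightarrow>
      (k, l) \<in> {(a, b). \<exists>i\<in>I. B i a > 0 \<and> E i a \<and> E i b \<and> a \<in> J \<and> b \<in> J}\<^sup>*"
    and r: "r i0 > 0" and entry: "i0 \<in> I" "k \<in> J" "E i0 k"
  shows "\<exists>B'. transport I J E r c B' \<and> B' i0 k > 0"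
proof (cases "B i0 k = 0")
  case False
  then show ?thesis using B entry by (intro exI[of _ B]) (force simp: transport_def)
next
  case True
  have "\<exists>j\<in>J. B i0 j > 0"
  proof (rule ccontr)
    assume "\<not> ?thesis"
    then have "(\<Sum>j\<in>J. B i0 j) \<le> 0" by (intro sum_nonpos) force
    then show False using B r entry(1) by (simp add: transport_def)
  qed
  then obtain j0 where j0: "j0 \<in> J" "B i0 j0 > 0" by blast
  then have E_j0: "E i0 j0" using B entry(1) by (force simp: transport_def)
  obtain X :: "'a \<Rightarrow> 'b \<Rightarrow> real" where X: "\<forall>i j. B i j = 0 \<longrightarrow> 0 \<le> X i j" "\<forall>i j. \<not> E i j \<longrightarrow> X i j = 0"
    "\<forall>i\<in>I. (\<Sum>j\<in>J. X i j) = 0"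
    "\<forall>j\<in>J. (\<Sum>i\<in>I. X i j) = of_bool (j = j0) - of_bool (j = k)"
    using ex_shift_along_path[OF fin reach[OF entry(2) j0(1)]]
    by blast
  define Y where "Y i j = X i j + of_bool (i = i0) * (of_bool (j = k) - of_bool (j = j0))" for i j
  have sum_J: "(\<Sum>j\<in>J. of_bool (j = x) :: real) = 1" if "x \<in> J" for x
    using fin(2) that by (simp add: of_bool_def)
  have sum_I: "(\<Sum>i\<in>I. of_bool (i = i0) :: real) = 1"
    using fin(1) entry(1) by (simp add: of_bool_def)
  have Y_nonneg: "0 \<le> Y i j" if "B i j = 0" for i j
    using X(1)[rule_format, OF that] that j0(2) by (auto simp: Y_def)
  have Y_zero: "Y i j = 0" if "\<not> E i j" for i j
    using X(2)[rule_format, OF that] that E_j0 entry(3) by (auto simp: Y_def)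
  have Y_row: "(\<Sum>j\<in>J. Y i j) = 0" if "i \<in> I" for i
    using X(3)[rule_format, OF that] j0(1) entry(2)
    by (simp add: Y_def sum.distrib sum_subtractf sum_J flip: sum_distrib_left)
  have Y_col: "(\<Sum>i\<in>I. Y i j) = 0" if "j \<in> J" for j
    using X(4)[rule_format, OF that]
    by (simp add: Y_def sum.distrib sum_I flip: sum_distrib_right)
  \<comment> \<open>As \<open>B i0 k = 0\<close>, the return path does not lower this entry, so it
    cannot cancel the unit gained there.\<close>
  have "k \<noteq> j0" using True j0 by auto
  then have Y_pos: "Y i0 k > 0" using X(1)[rule_format, OF True] by (simp add: Y_def)
  have "\<exists>e>0. \<forall>x\<in>I \<times> J. 0 \<le> B (fst x) (snd x) + e * Y (fst x) (snd x)"
    using B fin Y_nonneg by (intro ex_nonneg_step) (auto simp: transport_def)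
  then obtain e where e: "e > 0" "\<And>i j. i \<in> I \<Longrightarrow> j \<in> J \<Longrightarrow> 0 \<le> B i j + e * Y i j"
    by fastforce
  have "transport I J E r c (\<lambda>i j. B i j + e * Y i j)"
    using B e(2) Y_zero Y_row Y_col
    by (auto simp: transport_def sum.distrib simp flip: sum_distrib_left)
  moreover have "B i0 k + e * Y i0 k > 0" using True e(1) Y_pos by simp
  ultimately show ?thesis by blast
qed

text \<open>The constraints are linear equations and inequalities, so the set of solutions is
  convex.\<close>

lemma transport_average:
  assumes K: "finite K" "K \<noteq> {}" and F: "\<And>x. x \<in> K \<Longrightarrow> transport I J E r c (F x)"
  shows "transport I J E r c (\<lambda>i j. (\<Sum>x\<in>K. F x i j) / card K)"
proof -
  have K_pos: "real (card K) > 0" using K by (simp add: card_gt_0_iff)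
  have "(\<Sum>j\<in>J. (\<Sum>x\<in>K. F x i j) / card K) = r i" if "i \<in> I" for i
  proof -
    have "(\<Sum>j\<in>J. \<Sum>x\<in>K. F x i j) = (\<Sum>x\<in>K. \<Sum>j\<in>J. F x i j)" by (rule sum.swap)
    also have "\<dots> = card K * r i" using F that by (simp add: transport_def)
    finally show ?thesis using K_pos by (simp flip: sum_divide_distrib)
  qed
  moreover have "(\<Sum>i\<in>I. (\<Sum>x\<in>K. F x i j) / card K) = c j" if "j \<in> J" for j
  proof -
    have "(\<Sum>i\<in>I. \<Sum>x\<in>K. F x i j) = (\<Sum>x\<in>K. \<Sum>i\<in>I. F x i j)" by (rule sum.swap)
    also have "\<dots> = card K * c j" using F that by (simp add: transport_def)
    finally show ?thesis using K_pos by (simp flip: sum_divide_distrib)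
  qed
  moreover have "0 \<le> (\<Sum>x\<in>K. F x i j) / card K" if "i \<in> I" "j \<in> J" for i j
    using F that by (intro divide_nonneg_nonneg sum_nonneg) (auto simp: transport_def)
  moreover have "(\<Sum>x\<in>K. F x i j) / card K = 0" if "i \<in> I" "j \<in> J" "\<not> E i j" for i j
    using F that by (simp add: transport_def)
  ultimately show ?thesis by (simp add: transport_def)
qed

text \<open>For each allowed entry take a solution positive there. In the average of these, every
  allowed entry has one positive and otherwise nonnegative contributions.\<close>

lemma ex_transport_full_support:
  assumes fin: "finite I" "finite J" and B: "transport I J E r c B"
    and reach: "\<And>k l. k \<in> J \<Longrightarrow> l \<in> J \<Longrightarrow>
      (k, l) \<in> {(a, b). \<exists>i\<in>I. B i a > 0 \<and> E i a \<and> E i b \<and> a \<in> J \<and> b \<in> J}\<^sup>*"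
    and r: "\<And>i. i \<in> I \<Longrightarrow> r i > 0"
  shows "\<exists>B'. transport I J E r c B' \<and> (\<forall>i\<in>I. \<forall>j\<in>J. E i j \<longrightarrow> B' i j > 0)"
proof -
  define K where "K = {(i, j). i \<in> I \<and> j \<in> J \<and> E i j}"
  have fin_K: "finite K"
    by (rule finite_subset[OF _ finite_cartesian_product[OF fin]]) (auto simp: K_def)
  show ?thesis
  proof (cases "K = {}")
    \<comment> \<open>With no allowed entry there is nothing to average, and \<open>B\<close> itself
      qualifies vacuously.\<close>
    case True
    then show ?thesis using B by (auto simp: K_def)
  next
    case False
    have "\<forall>x\<in>K. \<exists>B'. transport I J E r c B' \<and> B' (fst x) (snd x) > 0"
      using ex_transport_positive_entry[OF fin B reach r] by (auto simp: K_def)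
    then obtain F where F: "\<And>x. x \<in> K \<Longrightarrow> transport I J E r c (F x)"
      "\<And>x. x \<in> K \<Longrightarrow> F x (fst x) (snd x) > 0"
      by metis
    have "(\<Sum>x\<in>K. F x i j) / card K > 0" if "i \<in> I" "j \<in> J" "E i j" for i j
    proof -
      have "(i, j) \<in> K" using that by (simp add: K_def)
      then have "(\<Sum>x\<in>K. F x i j) > 0"
        using F(1) F(2)[of "(i, j)"] that fin_K
        by (intro sum_pos2[of K "(i, j)"]) (auto simp: transport_def)
      then show ?thesis using fin_K False by (simp add: card_gt_0_iff)
    qed
    moreover have "transport I J E r c (\<lambda>i j. (\<Sum>x\<in>K. F x i j) / card K)"
      by (rule transport_average[OF fin_K False F(1)])
    ultimately show ?thesis by blast
  qed
qed

section \<open>Choice datasets\<close>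

text \<open>Injectivity of \<open>f\<close> lets each list element be counted for at most one index.
  \<open>P\<close> can fix the other component of an observation, so row sums, column sums and
  totals over a set of items are all instances.\<close>

lemma sum_length_filter_eq:
  assumes "finite K" and "inj_on f K"
  shows "(\<Sum>i\<in>K. length (filter (\<lambda>x. P x \<and> g x = f i) xs))
    = length (filter (\<lambda>x. P x \<and> g x \<in> f ` K) xs)"
proof (induction xs)
  case (Cons x xs)
  have "(\<Sum>i\<in>K. length (filter (\<lambda>x. P x \<and> g x = f i) (x # xs)))
      = (\<Sum>i\<in>K. of_bool (P x \<and> g x = f i)) + (\<Sum>i\<in>K. length (filter (\<lambda>x. P x \<and> g x = f i) xs))"
    by (simp add: sum.distrib[symmetric] if_distrib cong: sum.cong) (rule sum.cong, auto)
  moreover have "(\<Sum>i\<in>K. of_bool (P x \<and> g x = f i)) = (of_bool (P x \<and> g x \<in> f ` K) :: nat)"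
  proof (cases "P x \<and> g x \<in> f ` K")
    case True
    then obtain i where i: "i \<in> K" "g x = f i" by auto
    have "(\<Sum>i\<in>K. of_bool (P x \<and> g x = f i)) = (\<Sum>l\<in>K. if i = l then 1 else 0 :: nat)"
      using True i assms(2) by (intro sum.cong) (auto dest: inj_onD)
    then show ?thesis using True i assms(1) by simp
  next
    case False
    then show ?thesis by (auto intro!: sum.neutral)
  qed
  ultimately show ?case using Cons.IH by simp
qed simp

lemma connectivityE:
  assumes "connectivity m D" "U \<subseteq> {..<m}" "U \<noteq> {}" "{..<m} - U \<noteq> {}"
  obtains j k C where "j \<in> U" "k \<in> {..<m} - U" "C \<in> choice_sets D" "j \<in> C" "k \<in> C"
proof -
  have "\<exists>j\<in>U. \<exists>k\<in>{..<m} - U. \<exists>C\<in>choice_sets D. j \<in> C \<and> k \<in> C"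
    using assms by (simp add: connectivity_def)
  then show ?thesis by (elim bexE conjE) (rule that)
qed

lemma strong_connectivityE:
  assumes "strong_connectivity m D" "U \<subseteq> {..<m}" "U \<noteq> {}" "{..<m} - U \<noteq> {}"
  obtains j k where "j \<in> U" "k \<in> {..<m} - U" "selected_over D j k"
proof -
  have "\<exists>j\<in>U. \<exists>k\<in>{..<m} - U. selected_over D j k"
    using assms by (simp add: strong_connectivity_def)
  then show ?thesis by (elim bexE) (rule that)
qed

lemma strong_connectivity_imp_connectivity:
  assumes "strong_connectivity m D"
  shows "connectivity m D"
  unfolding connectivity_def
proof (intro allI impI, elim conjE)
  fix U assume U: "U \<subseteq> {..<m}" "U \<noteq> {}" "{..<m} - U \<noteq> {}"
  obtain j k where jk: "j \<in> U" "k \<in> {..<m} - U" and "selected_over D j k"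
    by (rule strong_connectivityE[OF assms U])
  then obtain C where "(C, j) \<in> set D" "j \<in> C" "k \<in> C" by (auto simp: selected_over_def)
  moreover from this have "C \<in> choice_sets D" by (force simp: choice_sets_def)
  ultimately show "\<exists>j\<in>U. \<exists>k\<in>{..<m} - U. \<exists>C\<in>choice_sets D. j \<in> C \<and> k \<in> C"
    using jk by blast
qed

text \<open>The items reachable from \<open>k\<close> include \<open>k\<close> and are closed under
  selection edges; if they missed \<open>l\<close>, they would be a cut across which no inside item
  is selected over an outside one.\<close>

lemma strong_connectivity_reachable:
  assumes "strong_connectivity m D" "k < m" "l < m"
  shows "(k, l) \<in> {(a, b). a < m \<and> b < m \<and> selected_over D a b}\<^sup>*" (is "_ \<in> ?R\<^sup>*")
proof (rule ccontr)
  assume l: "(k, l) \<notin> ?R\<^sup>*"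
  define U where "U = {x. x < m \<and> (k, x) \<in> ?R\<^sup>*}"
  have "U \<subseteq> {..<m}" "U \<noteq> {}" "{..<m} - U \<noteq> {}"
    using assms l by (auto simp: U_def)
  then obtain a b where "a \<in> U" "b \<in> {..<m} - U" "selected_over D a b"
    by (rule strong_connectivityE[OF assms(1)])
  then have "(k, a) \<in> ?R\<^sup>*" "(a, b) \<in> ?R" "b < m" "b \<notin> U" by (auto simp: U_def)
  then show False by (auto simp: U_def dest: rtrancl_into_rtrancl)
qed

lemma connectivity_iff_indecomposable:
  fixes A :: "real mat"
  assumes sets: "choice_sets D = S ` {..<n}"
    and S: "\<And>i. i < n \<Longrightarrow> S i \<subseteq> {..<m} \<and> S i \<noteq> {}"
    and A: "A = mat n m (\<lambda>(i, j). if j \<in> S i then 1 else 0)"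
  shows "connectivity m D \<longleftrightarrow> indecomposable A"
proof
  assume conn: "connectivity m D"
  show "indecomposable A"
    unfolding indecomposable_iff_no_bipartition
  proof (intro notI, elim exE)
    fix N M assume "bipartition A N M"
    then have N: "N \<subseteq> {..<n}" and M: "M \<subseteq> {..<m}" and ne: "N \<noteq> {} \<or> M \<noteq> {}"
      and nf: "N \<noteq> {..<n} \<or> M \<noteq> {..<m}"
      and zero: "\<And>i j. i < n \<Longrightarrow> j < m \<Longrightarrow> (i \<in> N) \<noteq> (j \<in> M) \<Longrightarrow> A $$ (i, j) = 0"
      by (simp_all add: bipartition_def A)
    have block: "i \<in> N \<longleftrightarrow> j \<in> M" if "i < n" "j \<in> S i" for i j
      using zero[of i j] S[OF that(1)] that by (auto simp: A)
    \<comment> \<open>Every row meets some column since choice sets are nonempty, so an empty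
      \<open>M\<close> would force an empty \<open>N\<close>. In the same way a full
      \<open>M\<close> forces a full \<open>N\<close>.\<close>
    have "M \<noteq> {}" using ne N block S by blast
    moreover have "{..<m} - M \<noteq> {}"
    proof
      assume "{..<m} - M = {}"
      then have "M = {..<m}" using M by blast
      then have "N = {..<n}" using N block S by blast
      then show False using nf \<open>M = {..<m}\<close> by simp
    qed
    ultimately obtain j k C where "j \<in> M" "k \<in> {..<m} - M" "C \<in> choice_sets D" "j \<in> C" "k \<in> C"
      by (rule connectivityE[OF conn M])
    then obtain i where "i < n" "j \<in> S i" "k \<in> S i" unfolding sets by blast
    then have "j \<in> M \<longleftrightarrow> k \<in> M" using block by blast
    then show False using \<open>j \<in> M\<close> \<open>k \<in> {..<m} - M\<close> by blast
  qed
next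
  assume indec: "indecomposable A"
  show "connectivity m D"
    unfolding connectivity_def
  proof (intro allI impI, elim conjE, rule ccontr)
    fix U
    assume U: "U \<subseteq> {..<m}" "U \<noteq> {}" "{..<m} - U \<noteq> {}"
      and no: "\<not> (\<exists>j\<in>U. \<exists>k\<in>{..<m} - U. \<exists>C\<in>choice_sets D. j \<in> C \<and> k \<in> C)"
    \<comment> \<open>As no choice set crosses \<open>U\<close>, a row that meets \<open>U\<close>
      has all its items in \<open>U\<close>.\<close>
    define N where "N = {i. i < n \<and> S i \<inter> U \<noteq> {}}"
    have "i \<in> N \<longleftrightarrow> j \<in> U" if "i < n" "j \<in> S i" "j < m" for i j
      using no that unfolding sets N_def by blast
    then have "A $$ (i, j) = 0" if "i < n" "j < m" "(i \<in> N) \<noteq> (j \<in> U)" for i j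
      using that by (auto simp: A)
    moreover have "N \<subseteq> {..<n}" "U \<noteq> {..<m}" using U(3) by (auto simp: N_def)
    moreover have "dim_row A = n" "dim_col A = m" by (simp_all add: A)
    ultimately have "bipartition A N U"
      using U unfolding bipartition_def by simp
    then show False using indec indecomposable_iff_no_bipartition by blast
  qed
qed

theorem proposition1:
  fixes m n :: nat
    and D :: "(nat set \<times> nat) list"
    and S :: "nat \<Rightarrow> nat set"
    and p q :: "real vec"
    and A :: "real mat"
  assumes dataset: "choice_dataset m D"
    and enum: "bij_betw S {..<n} (choice_sets D)"
    and two_items: "\<forall>i<n. 2 \<le> card (S i)"
    and p: "p = vec n (\<lambda>i. real (num_obs D (S i)))"
    and q: "q = vec m (\<lambda>j. real (num_wins D j))"
    and A: "A = mat n m (\<lambda>(i, j). if j \<in> S i then 1 else 0)"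
    and p_pos: "\<forall>i<n. 0 < p $ i"
    and q_pos: "\<forall>j<m. 0 < q $ j"
  shows "(connectivity m D \<longleftrightarrow> indecomposable A) \<and>
         (strong_connectivity m D \<longleftrightarrow> strong_existence A p q \<and> indecomposable A)"
proof -
  have inj: "inj_on S {..<n}" and sets: "choice_sets D = S ` {..<n}"
    using enum by (auto simp: bij_betw_def)
  have obs: "C \<subseteq> {..<m} \<and> j \<in> C \<and> C \<in> S ` {..<n}" if "(C, j) \<in> set D" for C j
  proof -
    have "C \<in> fst ` set D" using that image_eqI[of C fst "(C, j)"] by simp
    then show ?thesis using dataset that sets unfolding choice_dataset_def choice_sets_def by blast
  qed
  have S: "S i \<subseteq> {..<m} \<and> S i \<noteq> {}" if "i < n" for i
  proof -
    have "S i \<in> fst ` set D" using sets that by (auto simp: choice_sets_def)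
    then obtain j where "(S i, j) \<in> set D" by auto
    then show ?thesis using obs by blast
  qed
  note conn_iff = connectivity_iff_indecomposable[OF sets S A]
  have existence: "strong_existence A p q" if sc: "strong_connectivity m D"
  proof -
    define E where "E i j \<longleftrightarrow> j \<in> S i" for i j
    define B where "B i j = real (length (filter (\<lambda>ob. fst ob = S i \<and> snd ob = j) D))" for i j
    have B_pos: "B i j > 0 \<longleftrightarrow> (S i, j) \<in> set D" for i j
      by (force simp: B_def filter_empty_conv)
    have "B i j = 0" if "\<not> E i j" for i j
    proof -
      have "(S i, j) \<notin> set D" using obs that by (auto simp: E_def)
      then show ?thesis using B_pos[of i j] by (simp add: B_def)
    qed
    moreover have "(\<Sum>j<m. B i j) = p $ i" if "i < n" for i
    proof -
      have "(\<Sum>j<m. length (filter (\<lambda>ob. fst ob = S i \<and> snd ob = j) D))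
          = length (filter (\<lambda>ob. fst ob = S i \<and> snd ob \<in> (\<lambda>j. j) ` {..<m}) D)"
        by (rule sum_length_filter_eq) auto
      also have "\<dots> = num_obs D (S i)"
        unfolding num_obs_def using obs by (intro arg_cong[where f = length] filter_cong) fastforce+
      finally show ?thesis using that by (simp add: B_def p flip: of_nat_sum)
    qed
    moreover have "(\<Sum>i<n. B i j) = q $ j" if "j < m" for j
    proof -
      have "(\<Sum>i<n. length (filter (\<lambda>ob. snd ob = j \<and> fst ob = S i) D))
          = length (filter (\<lambda>ob. snd ob = j \<and> fst ob \<in> S ` {..<n}) D)"
        by (rule sum_length_filter_eq) (use inj in auto)
      also have "\<dots> = num_wins D j"
        unfolding num_wins_def using obs by (intro arg_cong[where f = length] filter_cong) fastforce+
      finally show ?thesis using that by (simp add: B_def q conj_commute flip: of_nat_sum)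
    qed
    ultimately have B: "transport {..<n} {..<m} E (($) p) (($) q) B"
      by (simp add: transport_def B_def)
    \<comment> \<open>If \<open>a\<close> is selected over \<open>b\<close>, some \<open>S i\<close>
      contains both and \<open>B i a\<close> is positive, so mass in row \<open>i\<close> may move
      from \<open>a\<close> to \<open>b\<close>. Edges therefore run from the selected item to the
      other one.\<close>
    have "{(a, b). a < m \<and> b < m \<and> selected_over D a b}
        \<subseteq> {(a, b). \<exists>i\<in>{..<n}. B i a > 0 \<and> E i a \<and> E i b \<and> a \<in> {..<m} \<and> b \<in> {..<m}}"
      (is "?R \<subseteq> ?T")
      using obs by (fastforce simp: selected_over_def B_pos E_def)
    then have reach: "(k, l) \<in> ?T\<^sup>*" if "k \<in> {..<m}" "l \<in> {..<m}" for k l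
      using strong_connectivity_reachable[OF sc, of k l] rtrancl_mono[of ?R ?T] that by blast
    have "0 < p $ i" if "i \<in> {..<n}" for i using p_pos that by simp
    from ex_transport_full_support[OF finite_lessThan finite_lessThan B reach this]
    obtain B' where B': "transport {..<n} {..<m} E (($) p) (($) q) B'"
      "\<forall>i\<in>{..<n}. \<forall>j\<in>{..<m}. E i j \<longrightarrow> B' i j > 0"
      by blast
    have "B' i j = 0 \<longleftrightarrow> j \<notin> S i" if "i < n" "j < m" for i j
      using B' that by (force simp: transport_def E_def)
    then show ?thesis
      unfolding strong_existence_def A using B'(1)
      by (intro bexI[of _ "mat n m (\<lambda>(i, j). B' i j)"]) (auto simp: transport_def)
  qed
  have strong: "strong_connectivity m D"
    if se: "strong_existence A p q" and conn: "connectivity m D"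
    unfolding strong_connectivity_def
  proof (intro allI impI, elim conjE, rule ccontr)
    fix U
    assume U: "U \<subseteq> {..<m}" "U \<noteq> {}" "{..<m} - U \<noteq> {}"
      and no: "\<not> (\<exists>j\<in>U. \<exists>k\<in>{..<m} - U. selected_over D j k)"
    have dims: "dim_row A = n" "dim_col A = m" by (simp_all add: A)
    obtain A' where
      entries: "\<forall>i<n. \<forall>j<m. 0 \<le> A' $$ (i, j) \<and> (A' $$ (i, j) = 0 \<longleftrightarrow> A $$ (i, j) = 0)"
      and rows: "\<forall>i<n. (\<Sum>j<m. A' $$ (i, j)) = p $ i"
      and cols: "\<forall>j<m. (\<Sum>i<n. A' $$ (i, j)) = q $ j"
      using se unfolding strong_existence_def dims by blast
    have A'_nonneg: "0 \<le> A' $$ (i, j)" and A'_zero: "A' $$ (i, j) = 0 \<longleftrightarrow> j \<notin> S i"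
      if "i < n" "j < m" for i j
      using entries that by (simp_all add: A)
    define N where "N = {i. i < n \<and> S i \<subseteq> U}"
    have N: "N \<subseteq> {..<n}" "finite N" by (auto simp: N_def)
    have fin_U: "finite U" using U(1) finite_subset by blast
    \<comment> \<open>An observation selecting from \<open>U\<close> has no item outside
      \<open>U\<close>, since that item would be beaten from \<open>U\<close>. Conversely, a choice
      set inside \<open>U\<close> can only yield a selection in \<open>U\<close>.\<close>
    have closed: "snd ob \<in> U \<longleftrightarrow> fst ob \<in> S ` N" if ob: "ob \<in> set D" for ob
    proof -
      obtain C j where Cj: "ob = (C, j)" by fastforce
      then have Cj_in: "(C, j) \<in> set D" using ob by simp
      obtain i where i: "i < n" "C = S i" and C: "C \<subseteq> {..<m}" "j \<in> C"
        using obs[OF Cj_in] by blast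
      have "C \<subseteq> U" if "j \<in> U"
        using no that Cj_in C unfolding selected_over_def by blast
      then have "j \<in> U \<longleftrightarrow> C \<subseteq> U" using C(2) by blast
      also have "\<dots> \<longleftrightarrow> C \<in> S ` N" using i by (auto simp: N_def)
      finally show ?thesis by (simp add: Cj)
    qed
    have "(\<Sum>j\<in>U. num_wins D j) = (\<Sum>i\<in>N. num_obs D (S i))"
    proof -
      have "(\<Sum>j\<in>U. num_wins D j) = length (filter (\<lambda>ob. snd ob \<in> U) D)"
        using sum_length_filter_eq[OF fin_U inj_on_id2, of "\<lambda>_. True" snd D]
        by (simp add: num_wins_def)
      also have "\<dots> = length (filter (\<lambda>ob. fst ob \<in> S ` N) D)"
        using closed by (intro arg_cong[where f = length] filter_cong) auto
      also have "\<dots> = (\<Sum>i\<in>N. num_obs D (S i))"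
        using sum_length_filter_eq[OF N(2) inj_on_subset[OF inj N(1)], of "\<lambda>_. True" fst D]
        by (simp add: num_obs_def)
      finally show ?thesis .
    qed
    moreover have "(\<Sum>j\<in>U. q $ j) = real (\<Sum>j\<in>U. num_wins D j)"
      using U(1) unfolding of_nat_sum by (intro sum.cong) (auto simp: q)
    moreover have "(\<Sum>i\<in>N. p $ i) = real (\<Sum>i\<in>N. num_obs D (S i))"
      using N(1) unfolding of_nat_sum by (intro sum.cong) (auto simp: p)
    ultimately have eq: "(\<Sum>j\<in>U. q $ j) = (\<Sum>i\<in>N. p $ i)" by simp
    \<comment> \<open>Rows in \<open>N\<close> have their support inside \<open>U\<close>, so their
      whole mass lies in the columns of \<open>U\<close>.\<close>
    have "(\<Sum>i\<in>N. p $ i) = (\<Sum>i\<in>N. \<Sum>j\<in>U. A' $$ (i, j))"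
    proof (rule sum.cong)
      fix i assume i: "i \<in> N"
      have "(\<Sum>j<m. A' $$ (i, j)) = (\<Sum>j\<in>U. A' $$ (i, j))"
        using i U(1) A'_zero by (intro sum.mono_neutral_right) (auto simp: N_def)
      then show "p $ i = (\<Sum>j\<in>U. A' $$ (i, j))" using rows i by (simp add: N_def)
    qed simp
    moreover have "(\<Sum>j\<in>U. q $ j) = (\<Sum>i<n. \<Sum>j\<in>U. A' $$ (i, j))"
      using cols U(1) by (subst sum.swap) (auto intro!: sum.cong)
    moreover have "(\<Sum>i<n. \<Sum>j\<in>U. A' $$ (i, j))
        = (\<Sum>i\<in>{..<n} - N. \<Sum>j\<in>U. A' $$ (i, j)) + (\<Sum>i\<in>N. \<Sum>j\<in>U. A' $$ (i, j))"
      using N(1) by (intro sum.subset_diff) auto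
    \<comment> \<open>The rows in \<open>N\<close> already exhaust the column totals of
      \<open>U\<close>, so the other rows have no mass there. By the zero pattern of
      \<open>A'\<close>, their choice sets then avoid \<open>U\<close>.\<close>
    ultimately have zero: "(\<Sum>i\<in>{..<n} - N. \<Sum>j\<in>U. A' $$ (i, j)) = 0" using eq by simp
    have nonneg: "0 \<le> A' $$ (i, j)" if "i \<in> {..<n} - N" "j \<in> U" for i j
      using A'_nonneg U(1) that by auto
    have disjoint: "j \<notin> S i" if i: "i \<in> {..<n} - N" and j: "j \<in> U" for i j
    proof -
      have "\<forall>i\<in>{..<n} - N. (\<Sum>j\<in>U. A' $$ (i, j)) = 0"
        using zero nonneg by (subst (asm) sum_nonneg_eq_0_iff) (auto intro: sum_nonneg)
      then have "(\<Sum>j\<in>U. A' $$ (i, j)) = 0" using i by blast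
      then have "A' $$ (i, j) = 0"
        by (intro sum_nonneg_0[of U "\<lambda>j. A' $$ (i, j)", OF fin_U nonneg[OF i] _ j])
      moreover have "i < n" "j < m" using i j U(1) by auto
      ultimately show ?thesis using A'_zero by blast
    qed
    \<comment> \<open>A choice set crossing \<open>U\<close> is not inside \<open>U\<close>, so its
      row is outside \<open>N\<close>, yet it meets \<open>U\<close>.\<close>
    obtain j k C where "j \<in> U" "k \<in> {..<m} - U" "C \<in> choice_sets D" "j \<in> C" "k \<in> C"
      by (rule connectivityE[OF conn U])
    then obtain i where i: "i < n" "j \<in> S i" "k \<in> S i" unfolding sets by blast
    then have "i \<in> {..<n} - N" using \<open>k \<in> {..<m} - U\<close> by (auto simp: N_def)
    then show False using disjoint \<open>j \<in> U\<close> i(2) by blast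
  qed
  show ?thesis
    using conn_iff existence strong strong_connectivity_imp_connectivity by blast
qed

end
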